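(* Let $G$ be a graph with $n$ vertices such that $d_G(x) + d_G(y) \geq n +1$ for every pair of distinct vertices $x \neq y$ with $xy \notin E(G)$. (1) If $n = 4k-1$ for some positive integer $k$, then $G$ contains at least $k(2k-1) = \frac{n^2-1}{8}$ triangles. (2) If $n = 4k+1$ for some positive integer $k$, then $G$ contains at least $2k(k+1) = \frac{n^2+2n-3}{8}$ triangles.
   Context: Graphs are finite and simple; $d_G(x)$ denotes the degree of the vertex $x$ in $G$. The number of triangles is the number of subgraphs of $G$ isomorphic to $K_3$. *)

theory Defs
  imports Complex_Main "Graph_Theory.Graph_Theory"
begin

text \<open>
  A finite simple graph is a \<^term>\<open>graph G\<close> in the sense of Graph\_Theory: an
  undirected edge \<open>xy\<close> is represented by exactly two opposite arcs. Hence
  \<^term>\<open>out_degree G x\<close> is the number of edges at \<open>x\<close>, counted once each.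
  A subgraph shares \<^const>\<open>tail\<close> and \<^const>\<open>head\<close> with its host graph, so it is
  determined by its vertex and arc sets, and \<^const>\<open>complete_digraph\<close> itself
  requires its argument to be a \<^const>\<open>graph\<close>; so every undirected triangle
  occurs exactly once in the following set.
\<close>

definition triangles :: "('a, 'b) pre_digraph \<Rightarrow> ('a, 'b) pre_digraph set" where
  "triangles G = {H. subgraph H G \<and> K\<^bsub>3\<^esub> H}"

lemma out_degree_eq_card_neighbours:
  assumes "graph G"
  shows "out_degree G x = card {y. x \<rightarrow>\<^bsub>G\<^esub> y}"
proof -
  interpret graph G by fact
  have "{y. x \<rightarrow>\<^bsub>G\<^esub> y} = head G ` out_arcs G x"
    by (auto simp: out_arcs_def arcs_ends_conv)
  moreover have "inj_on (head G) (out_arcs G x)"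
    by (rule inj_onI) (auto simp: out_arcs_def arc_to_ends_def intro: no_multi_arcs)
  ultimately show ?thesis
    by (simp add: out_degree_def card_image)
qed

lemma bij_betw_verts_triangles:
  assumes "graph G"
  shows "bij_betw verts (triangles G)
    {T. T \<subseteq> verts G \<and> card T = 3 \<and> (\<forall>x\<in>T. \<forall>y\<in>T. x \<noteq> y \<longrightarrow> x \<rightarrow>\<^bsub>G\<^esub> y)}"
    (is "bij_betw _ _ ?T")
proof -
  interpret graph G by fact
  let ?A = "\<lambda>T. {e \<in> arcs G. tail G e \<in> T \<and> head G e \<in> T}"
  let ?f = "\<lambda>T. \<lparr>verts = T, arcs = ?A T, tail = tail G, head = head G\<rparr>"
  have fin: "?f (verts H) = H \<and> verts H \<in> ?T" if "H \<in> triangles G" for H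
  proof -
    have s: "verts H \<subseteq> verts G" "arcs H \<subseteq> arcs G" and t: "tail H = tail G" "head H = head G"
      and K: "graph H" "card (verts H) = 3"
        "arcs_ends H = {(u,v). (u,v) \<in> verts H \<times> verts H \<and> u \<noteq> v}"
      using that by (auto simp: triangles_def subgraph_def compatible_def complete_digraph_def)
    interpret H: graph H by fact
    have "e \<in> arcs H" if e: "e \<in> arcs G" "tail G e \<in> verts H" "head G e \<in> verts H" for e
    proof -
      have "(tail G e, head G e) \<in> arcs_ends H"
        using e no_loops K(3) by auto
      then obtain e' where e': "e' \<in> arcs H" "tail G e' = tail G e" "head G e' = head G e"
        by (auto simp: arcs_ends_conv t)
      then have "e' = e" using s e by (intro no_multi_arcs) (auto simp: arc_to_ends_def)
      then show ?thesis using e' by simp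
    qed
    then have "?A (verts H) = arcs H"
      using s H.tail_in_verts H.head_in_verts by (auto simp: t)
    then have "?f (verts H) = H" by (simp flip: t)
    moreover have "arcs_ends H \<subseteq> arcs_ends G"
      using s by (auto simp: arcs_ends_conv t)
    ultimately show ?thesis using s K by auto
  qed
  have bwd: "?f T \<in> triangles G" if T: "T \<in> ?T" for T
  proof -
    have finT: "finite T" using T by (auto intro: card_ge_0_finite)
    have e: "arcs_ends (?f T) = {(u,v). (u,v) \<in> T \<times> T \<and> u \<noteq> v}"
      using T no_loops by (fastforce simp: arcs_ends_conv)
    have "graph (?f T)"
      using finT no_loops no_multi_arcs
      by unfold_locales (auto simp: symmetric_def e arc_to_ends_def intro: symI)
    moreover have "wf_digraph (?f T)" by unfold_locales auto
    ultimately show ?thesis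
      using T e wf_digraph by (auto simp: triangles_def subgraph_def compatible_def complete_digraph_def)
  qed
  show ?thesis
    by (rule bij_betw_byWitness[where f' = ?f]) (use fin bwd in auto)
qed

lemma finite_triangles:
  assumes "graph G"
  shows "finite (triangles G)"
proof -
  interpret graph G by fact
  have "finite {T. T \<subseteq> verts G \<and> card T = 3 \<and> (\<forall>x\<in>T. \<forall>y\<in>T. x \<noteq> y \<longrightarrow> x \<rightarrow>\<^bsub>G\<^esub> y)}"
    by (rule finite_subset[of _ "Pow (verts G)"]) auto
  then show ?thesis
    using bij_betw_finite[OF bij_betw_verts_triangles[OF assms]] by blast
qed

end

theory Submission
  imports Defs
begin

text \<open>
  Write \<open>n = 2p + 1\<close>; both parts then ask for \<open>p * q\<close> triangles, with \<open>q = (p + 1) / 2\<close>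
  for odd \<open>p\<close> and \<open>q = (p + 2) / 2\<close> for even \<open>p\<close>. The proof separates into a statement on
  the number of edges and the case \<open>2q \<le> p + 2\<close> of the theorem of Lovasz and Simonovits: a graph
  with at least \<open>\<lfloor>n\<^sup>2/4\<rfloor> + q\<close> edges has at least \<open>q * \<lfloor>n/2\<rfloor>\<close> triangles.
  
  Edges (\<open>ore_arc_count\<close>). Summing the degree hypothesis over all nonadjacent pairs weights
  the excess \<open>e(x) = d(x) - (p + 1)\<close> of a vertex by its number \<open>p - 1 - e(x)\<close> of
  non-neighbours. This yields \<open>(p - 1) * (\<Sum>x. e(x)) \<ge> (\<Sum>x. e(x)\<^sup>2) \<ge> 0\<close>, so the average degree
  is at least \<open>p + 1\<close>, and there are at least \<open>p\<^sup>2 + p + q\<close> edges.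
  
  A sparse bipartition (\<open>exists_neighbourhood_cut\<close>). Cut the vertex set into \<open>N(x)\<close> and its
  complement. The number of edges that this leaves uncut, summed over \<open>x\<close>, equals
  \<open>n * m - (\<Sum>y. d(y)\<^sup>2) + 6 * t\<close> for \<open>m\<close> edges and \<open>t\<close> triangles. If \<open>t < p * q\<close>, the sum is
  so small that some cut leaves fewer than \<open>2q\<close> edges, hence at most \<open>p + 1\<close>, and a minimum
  cut \<open>(A, B)\<close> does as well.
  
  Triangles across the cut (\<open>ordered_triangles_ge_cut\<close>, \<open>missing_cross_weight\<close>). An uncut
  edge in \<open>A\<close> makes a triangle with every vertex of \<open>B\<close> except those to which one of its ends
  misses an edge. A missing pair \<open>uw\<close> across the cut thus destroys at most as many triangles as
  there are uncut edges at \<open>u\<close> and \<open>w\<close>, normally at most \<open>p\<close>. But each missing pair also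
  forces one more uncut edge, which is worth about \<open>p\<close> triangles, so missing pairs never pay. The one delicate
  situation, a pair \<open>uw\<close> that meets all \<open>p + 1\<close> uncut edges, can occur only once in a minimum
  cut, and the triangle that it costs is regained because \<open>B\<close> is larger than \<open>A\<close>.
\<close>

section \<open>Adjacency, degrees and edges inside a vertex set\<close>

text \<open>
  Counting takes place in the integers with a zero-one adjacency function, so that missing pairs
  are \<open>1 - edge x y\<close> and all counts are sums. Edges are counted once in each direction and
  triangles once for each of their six orderings.
\<close>

locale simple_graph_on =
  fixes V :: "'a set" and adj :: "'a \<Rightarrow> 'a \<Rightarrow> bool"
  assumes finite_V: "finite V"
    and adj_sym: "adj x y \<Longrightarrow> adj y x"
    and adj_irrefl: "\<not> adj x x"
begin

definition edge :: "'a \<Rightarrow> 'a \<Rightarrow> int" where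
  "edge x y = of_bool (adj x y)"

definition degree_into :: "'a set \<Rightarrow> 'a \<Rightarrow> int" where
  "degree_into S x = (\<Sum>y\<in>S. edge x y)"

definition arcs_within :: "'a set \<Rightarrow> int" where
  "arcs_within S = (\<Sum>x\<in>S. degree_into S x)"

definition uncut_arcs :: "'a set \<Rightarrow> int" where
  "uncut_arcs A = arcs_within A + arcs_within (V - A)"

definition triangle :: "'a \<Rightarrow> 'a \<Rightarrow> 'a \<Rightarrow> int" where
  "triangle x y z = edge x y * edge y z * edge x z"

definition ordered_triangles :: int where
  "ordered_triangles = (\<Sum>x\<in>V. \<Sum>y\<in>V. \<Sum>z\<in>V. triangle x y z)"

lemma edge_commute: "edge x y = edge y x"
  using adj_sym by (auto simp: edge_def)

lemma edge_self [simp]: "edge x x = 0"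
  by (simp add: edge_def adj_irrefl)

lemma edge_bounds: "0 \<le> edge x y" "edge x y \<le> 1"
  by (auto simp: edge_def)

lemma degree_into_nonneg: "0 \<le> degree_into S x"
  by (simp add: degree_into_def sum_nonneg edge_bounds)

lemma arcs_within_nonneg: "0 \<le> arcs_within S"
  by (simp add: arcs_within_def sum_nonneg degree_into_nonneg)

lemma degree_into_le_card:
  assumes "finite S" "y \<in> S" "edge x y = 0"
  shows "degree_into S x \<le> int (card S) - 1"
proof -
  have "degree_into S x = (\<Sum>z\<in>S - {y}. edge x z)"
    unfolding degree_into_def using assms by (simp add: sum.remove)
  also have "\<dots> \<le> (\<Sum>z\<in>S - {y}. 1)"
    by (intro sum_mono) (simp add: edge_bounds)
  also have "\<dots> = int (card S) - 1"
    using card_Suc_Diff1[OF assms(1,2)] by simp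
  finally show ?thesis .
qed

lemma arcs_within_remove:
  assumes "finite S" "u \<in> S"
  shows "arcs_within S = arcs_within (S - {u}) + 2 * degree_into S u"
proof -
  have *: "degree_into S x = edge x u + degree_into (S - {u}) x" for x
    using assms by (simp add: degree_into_def sum.remove)
  have "arcs_within S = degree_into S u + (\<Sum>x\<in>S - {u}. edge x u + degree_into (S - {u}) x)"
    unfolding arcs_within_def using assms by (subst sum.remove[OF assms]) (simp add: *)
  also have "(\<Sum>x\<in>S - {u}. edge x u + degree_into (S - {u}) x)
      = degree_into (S - {u}) u + arcs_within (S - {u})"
    by (simp add: sum.distrib arcs_within_def degree_into_def edge_commute[of _ u])
  finally show ?thesis using *[of u] by simp
qed

lemma arcs_within_even: "finite S \<Longrightarrow> even (arcs_within S)"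
proof (induction S rule: finite_induct)
  case empty
  then show ?case by (simp add: arcs_within_def)
next
  case (insert u S)
  then show ?case using arcs_within_remove[of "insert u S" u] by simp
qed

lemma arcs_within_ge_degree:
  assumes "finite S" "u \<in> S"
  shows "2 * degree_into S u \<le> arcs_within S"
  using arcs_within_remove[OF assms] arcs_within_nonneg[of "S - {u}"] by simp

text \<open>
  The equation says that every edge inside \<open>S\<close> has the end \<open>u\<close>, so all other vertices have at
  most that one neighbour in \<open>S\<close>.
\<close>

lemma degree_into_le_one_if_star:
  assumes "finite S" "u \<in> S" "arcs_within S = 2 * degree_into S u" "v \<in> S" "v \<noteq> u"
  shows "degree_into S v \<le> 1"
proof -
  have "2 * degree_into (S - {u}) v \<le> arcs_within (S - {u})"
    using assms by (intro arcs_within_ge_degree) auto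
  also have "\<dots> = 0" using arcs_within_remove[OF assms(1,2)] assms(3) by simp
  finally have "degree_into (S - {u}) v \<le> 0" by simp
  moreover have "degree_into S v = edge v u + degree_into (S - {u}) v"
    using assms by (simp add: degree_into_def sum.remove)
  ultimately show ?thesis using edge_bounds(2)[of v u] by simp
qed

section \<open>A neighbourhood that cuts almost all edges\<close>

lemma uncut_arcs_complement: "A \<subseteq> V \<Longrightarrow> uncut_arcs (V - A) = uncut_arcs A"
  by (simp add: uncut_arcs_def double_diff)

lemma sum_split: "A \<subseteq> V \<Longrightarrow> (\<Sum>x\<in>V. f x) = (\<Sum>x\<in>A. f x) + (\<Sum>x\<in>V - A. f x)" for f :: "'a \<Rightarrow> int"
  using sum.subset_diff[OF _ finite_V] by (simp add: add.commute)

lemma arcs_within_V_split: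
  assumes "A \<subseteq> V"
  shows "arcs_within V = uncut_arcs A + 2 * (\<Sum>x\<in>A. \<Sum>y\<in>V - A. edge x y)"
proof -
  have "(\<Sum>x\<in>V - A. \<Sum>y\<in>A. edge x y) = (\<Sum>x\<in>A. \<Sum>y\<in>V - A. edge x y)"
    by (subst sum.swap) (simp add: edge_commute)
  then show ?thesis
    by (simp add: arcs_within_def uncut_arcs_def degree_into_def sum_split[OF assms] sum.distrib)
qed

text \<open>
  An edge \<open>yz\<close> is cut by \<open>N(x)\<close>, with \<open>y\<close> inside, if \<open>xyz\<close> is a path and \<open>xz\<close> is not an edge.
  The paths of length two with centre \<open>y\<close> number \<open>d(y)\<^sup>2\<close> (degenerate ones included), and
  those that fail to give a cut edge are the ordered triangles.
\<close>

lemma sum_uncut_arcs_neighbourhoods: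
  "(\<Sum>x\<in>V. uncut_arcs {y\<in>V. adj x y})
    = int (card V) * arcs_within V - 2 * (\<Sum>y\<in>V. (degree_into V y)\<^sup>2) + 2 * ordered_triangles"
proof -
  have cut: "uncut_arcs {y\<in>V. adj x y}
      = arcs_within V - 2 * (\<Sum>y\<in>V. \<Sum>z\<in>V. edge x y * edge y z - triangle x y z)" for x
  proof -
    let ?N = "{y\<in>V. adj x y}"
    have "(\<Sum>y\<in>?N. \<Sum>z\<in>V - ?N. edge y z) = (\<Sum>y\<in>?N. \<Sum>z\<in>V. (1 - edge x z) * edge y z)"
      by (intro sum.cong sum.mono_neutral_cong_left refl) (auto simp: finite_V edge_def)
    also have "\<dots> = (\<Sum>y\<in>V. \<Sum>z\<in>V. edge x y * edge y z - triangle x y z)"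
      by (intro sum.mono_neutral_cong_left)
        (auto simp: finite_V edge_def triangle_def intro!: sum.cong)
    finally show ?thesis
      using arcs_within_V_split[of ?N] by simp
  qed
  have "(\<Sum>x\<in>V. \<Sum>y\<in>V. \<Sum>z\<in>V. edge x y * edge y z) = (\<Sum>y\<in>V. \<Sum>x\<in>V. \<Sum>z\<in>V. edge y x * edge y z)"
    by (subst sum.swap) (simp add: edge_commute)
  also have "\<dots> = (\<Sum>y\<in>V. (degree_into V y)\<^sup>2)"
    by (simp add: degree_into_def power2_eq_square sum_product)
  finally show ?thesis
    by (simp add: cut sum_subtractf ordered_triangles_def flip: sum_distrib_left)
qed

text \<open>
  A form of convexity adapted to integer degrees: no integer lies strictly between \<open>p\<close> and
  \<open>p + 1\<close>, so \<open>(d - p) * (d - p - 1) \<ge> 0\<close>.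
\<close>

lemma sum_degree_squares:
  fixes p :: int
  shows "int (card V) * (- p\<^sup>2 - p) + (2 * p + 1) * arcs_within V \<le> (\<Sum>y\<in>V. (degree_into V y)\<^sup>2)"
proof -
  have "- p\<^sup>2 - p + (2 * p + 1) * d \<le> d\<^sup>2" for d :: int
  proof -
    have "0 \<le> (d - p) * (d - p - 1)"
      by (cases "d \<le> p") (auto intro: mult_nonpos_nonpos mult_nonneg_nonneg)
    then show ?thesis by (simp add: algebra_simps power2_eq_square)
  qed
  then have "(\<Sum>y\<in>V. - p\<^sup>2 - p + (2 * p + 1) * degree_into V y) \<le> (\<Sum>y\<in>V. (degree_into V y)\<^sup>2)"
    by (intro sum_mono)
  then show ?thesis
    by (simp add: sum.distrib sum_distrib_left arcs_within_def)
qed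

text \<open>
  An averaging argument. With few triangles, the sum over \<open>x\<close> is less than
  \<open>12 * p * q - 2 * n * q\<close>, and this is at most \<open>4 * n * q\<close> for \<open>n = 2 * p + 1\<close>.
\<close>

lemma exists_neighbourhood_cut:
  fixes p q :: int
  assumes n: "int (card V) = 2 * p + 1" and m: "arcs_within V \<ge> 2 * (p\<^sup>2 + p + q)"
    and q: "0 \<le> q" and few: "ordered_triangles < 6 * p * q"
  obtains x where "x \<in> V" "uncut_arcs {y\<in>V. adj x y} < 4 * q"
proof -
  let ?n = "int (card V)" and ?M = "arcs_within V"
  have "?n * (- p\<^sup>2 - p) + ?n * ?M \<le> (\<Sum>y\<in>V. (degree_into V y)\<^sup>2)"
    using sum_degree_squares[of p] by (simp only: n)
  then have "(\<Sum>x\<in>V. uncut_arcs {y\<in>V. adj x y})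
      \<le> ?n * ?M - 2 * (?n * (- p\<^sup>2 - p) + ?n * ?M) + 2 * ordered_triangles"
    unfolding sum_uncut_arcs_neighbourhoods
    by (intro add_right_mono diff_left_mono mult_left_mono) auto
  also have "\<dots> = 2 * ordered_triangles - ?n * (?M - 2 * (p\<^sup>2 + p))"
    by (simp add: algebra_simps)
  also have "\<dots> < 12 * p * q - ?n * (?M - 2 * (p\<^sup>2 + p))"
    using few by simp
  also have "\<dots> \<le> 12 * p * q - ?n * (2 * q)"
    using m by (intro diff_left_mono mult_left_mono) auto
  also have "\<dots> \<le> ?n * (4 * q)"
    using n q by (simp add: algebra_simps)
  also have "\<dots> = (\<Sum>x\<in>V. 4 * q)" by simp
  finally have "\<not> (\<forall>x\<in>V. 4 * q \<le> uncut_arcs {y\<in>V. adj x y})"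
    using sum_mono[of V "\<lambda>_. 4 * q"] by (meson not_le)
  then show ?thesis using that by force
qed

section \<open>Triangles across a cut\<close>

text \<open>
  For an edge \<open>uv\<close> inside \<open>A\<close> and a vertex \<open>w\<close> outside, the indicator of a triangle is at least
  \<open>1\<close> minus one for each of \<open>uw\<close>, \<open>vw\<close> that is missing. A missing pair \<open>uw\<close> is charged once
  for each edge at \<open>u\<close> inside \<open>A\<close>, hence the weight \<open>degree_into A u\<close>.
\<close>

lemma two_plus_one_triangles:
  assumes "finite A" "finite B"
  shows "int (card B) * arcs_within A - 2 * (\<Sum>u\<in>A. \<Sum>w\<in>B. (1 - edge u w) * degree_into A u)
    \<le> (\<Sum>u\<in>A. \<Sum>v\<in>A. \<Sum>w\<in>B. triangle u v w)"
proof -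
  have sw: "(\<Sum>u\<in>A. \<Sum>v\<in>A. \<Sum>w\<in>B. edge u v * (1 - edge v w))
      = (\<Sum>u\<in>A. \<Sum>v\<in>A. \<Sum>w\<in>B. edge u v * (1 - edge u w))"
    by (subst sum.swap) (simp add: edge_commute)
  have eq: "(\<Sum>u\<in>A. \<Sum>v\<in>A. \<Sum>w\<in>B. edge u v * (1 - edge u w))
      = (\<Sum>u\<in>A. \<Sum>w\<in>B. (1 - edge u w) * degree_into A u)"
    unfolding degree_into_def sum_distrib_left
    by (rule sum.cong[OF refl], subst sum.swap) (simp add: mult.commute)
  have "int (card B) * arcs_within A = (\<Sum>u\<in>A. \<Sum>v\<in>A. \<Sum>w\<in>B. edge u v)"
    by (simp add: arcs_within_def degree_into_def sum_distrib_left)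
  then have "int (card B) * arcs_within A - 2 * (\<Sum>u\<in>A. \<Sum>w\<in>B. (1 - edge u w) * degree_into A u)
    = (\<Sum>u\<in>A. \<Sum>v\<in>A. \<Sum>w\<in>B. edge u v - edge u v * (1 - edge u w) - edge u v * (1 - edge v w))"
    using sw eq by (simp only: sum_subtractf)
  also have "\<dots> \<le> (\<Sum>u\<in>A. \<Sum>v\<in>A. \<Sum>w\<in>B. triangle u v w)"
    by (intro sum_mono) (auto simp: edge_def triangle_def)
  finally show ?thesis .
qed

lemma triangle_commute: "triangle x y z = triangle y x z" "triangle x y z = triangle x z y"
  by (simp_all add: triangle_def edge_commute)

text \<open>
  Among the six orderings of a triangle with two vertices in one part, two begin with these two
  vertices. This accounts for the factor \<open>3\<close>.
\<close>

lemma ordered_triangles_ge_cut: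
  assumes A: "A \<subseteq> V" and B: "B = V - A"
  shows "3 * (int (card B) * arcs_within A + int (card A) * arcs_within B
      - 2 * (\<Sum>u\<in>A. \<Sum>w\<in>B. (1 - edge u w) * (degree_into A u + degree_into B w)))
    \<le> ordered_triangles"
proof -
  define F where "F X Y Z = (\<Sum>x\<in>X. \<Sum>y\<in>Y. \<Sum>z\<in>Z. triangle x y z)" for X Y Z
  have fin: "finite A" "finite B" using A B finite_V by (auto intro: finite_subset)
  have F12: "F X Y Z = F Y X Z" for X Y Z
    unfolding F_def by (subst sum.swap) (simp add: triangle_commute(1))
  have F23: "F X Y Z = F X Z Y" for X Y Z
    unfolding F_def by (rule sum.cong[OF refl], subst sum.swap) (simp add: triangle_commute(2))
  have F0: "0 \<le> F X Y Z" for X Y Z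
    unfolding F_def triangle_def by (intro sum_nonneg mult_nonneg_nonneg edge_bounds)
  have "ordered_triangles = F A A A + F A A B + F A B A + F A B B + F B A A + F B A B + F B B A + F B B B"
    unfolding ordered_triangles_def F_def B
    by (simp add: sum_split[OF A] sum.distrib)
  also have "\<dots> \<ge> 3 * (F A A B + F B B A)"
    using F0[of A A A] F0[of B B B] F12[of A B A] F23[of A B A] F12[of B A B] F23[of B A B] by simp
  finally have "3 * (F A A B + F B B A) \<le> ordered_triangles" .
  moreover have "(\<Sum>u\<in>B. \<Sum>w\<in>A. (1 - edge u w) * degree_into B u)
      = (\<Sum>u\<in>A. \<Sum>w\<in>B. (1 - edge u w) * degree_into B w)"
    by (subst sum.swap) (simp add: edge_commute)
  ultimately show ?thesis
    using two_plus_one_triangles[OF fin] two_plus_one_triangles[OF fin(2,1)]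
    unfolding F_def by (simp add: distrib_left sum.distrib)
qed

section \<open>Minimum cuts\<close>

lemma exists_minimum_cut:
  fixes p :: nat
  assumes "card V = 2 * p + 1"
  obtains A where "A \<subseteq> V" "card A \<le> p" "\<And>S. S \<subseteq> V \<Longrightarrow> uncut_arcs A \<le> uncut_arcs S"
proof -
  have "finite (Pow V)" "Pow V \<noteq> {}" using finite_V by auto
  then obtain A where A: "A \<in> Pow V" "\<And>S. S \<in> Pow V \<Longrightarrow> uncut_arcs A \<le> uncut_arcs S"
    using arg_min_if_finite(1)[of "Pow V" uncut_arcs] arg_min_least[of "Pow V" _ uncut_arcs] by metis
  show ?thesis
  proof (cases "card A \<le> p")
    case True
    then show ?thesis using A that by auto
  next
    case False
    have "card (V - A) = card V - card A"
      using A finite_V by (intro card_Diff_subset) (auto intro: finite_subset)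
    then have "card (V - A) \<le> p" using False assms by simp
    then show ?thesis using A that[of "V - A"] uncut_arcs_complement by auto
  qed
qed

text \<open>
  Otherwise moving \<open>w\<close> to the other side would cut more edges.
\<close>

lemma minimum_cut_degree:
  assumes "A \<subseteq> V" "w \<in> V - A" and min: "uncut_arcs A \<le> uncut_arcs (insert w A)"
  shows "degree_into (V - A) w \<le> degree_into A w"
proof -
  have fin: "finite A" using assms finite_V by (auto intro: finite_subset)
  have "V - A - {w} = V - insert w A" by auto
  then have "arcs_within (V - A) = arcs_within (V - insert w A) + 2 * degree_into (V - A) w"
    using arcs_within_remove[of "V - A" w] assms finite_V by simp
  moreover have "arcs_within (insert w A) = arcs_within A + 2 * degree_into A w"
    using arcs_within_remove[of "insert w A" w] assms fin by (simp add: degree_into_def)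
  ultimately show ?thesis using min by (simp add: uncut_arcs_def)
qed

text \<open>
  The first alternative is the normal case, where every missing pair \<open>uw\<close> across the cut meets
  at most \<open>p\<close> uncut edges. There are at most \<open>p + 1\<close> uncut edges, so an exceptional pair \<open>uw\<close>
  meets all of them: the edges inside \<open>A\<close> form a star at \<open>u\<close>, those inside \<open>B\<close> a star at \<open>w\<close>.
  The size of \<open>A\<close> and the minimality of the cut keep both stars below \<open>p\<close> edges, so both have
  at least two edges, and no other pair is exceptional.
\<close>

lemma missing_cross_weight:
  fixes p :: int
  assumes A: "A \<subseteq> V" "int (card A) \<le> p" and B: "B = V - A"
    and min: "\<And>S. S \<subseteq> V \<Longrightarrow> uncut_arcs A \<le> uncut_arcs S"
    and small: "uncut_arcs A \<le> 2 * p + 2"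
  defines "W \<equiv> (\<Sum>u\<in>A. \<Sum>w\<in>B. (1 - edge u w) * (degree_into A u + degree_into B w))"
    and "miss \<equiv> (\<Sum>u\<in>A. \<Sum>w\<in>B. 1 - edge u w)"
  shows "W \<le> p * miss \<or> W \<le> p * miss + 1 \<and> 2 \<le> arcs_within A"
proof (cases "\<forall>u\<in>A. \<forall>w\<in>B. edge u w = 0 \<longrightarrow> degree_into A u + degree_into B w \<le> p")
  case True
  have "W \<le> (\<Sum>u\<in>A. \<Sum>w\<in>B. p * (1 - edge u w))"
    unfolding W_def using True by (intro sum_mono) (auto simp: edge_def)
  then show ?thesis by (simp add: miss_def sum_distrib_left)
next
  case False
  then obtain u w where uw: "u \<in> A" "w \<in> B" "edge u w = 0" "degree_into A u + degree_into B w \<ge> p + 1"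
    by force
  have fin: "finite A" "finite B" using A B finite_V by (auto intro: finite_subset)
  have "2 * degree_into A u \<le> arcs_within A" "2 * degree_into B w \<le> arcs_within B"
    using uw fin by (auto intro: arcs_within_ge_degree)
  then have star: "arcs_within A = 2 * degree_into A u" "arcs_within B = 2 * degree_into B w"
    and sum: "degree_into A u + degree_into B w = p + 1"
    using small uw unfolding uncut_arcs_def B by linarith+
  have u: "degree_into A u \<le> p - 1"
    using degree_into_le_card[of A u u] uw fin A by simp
  \<comment> \<open>\<open>B\<close> may have many more than \<open>p\<close> vertices, so its star is bounded through the edges from \<open>w\<close> to \<open>A\<close>.\<close>
  have "degree_into B w \<le> degree_into A w"
    using minimum_cut_degree[of A w] A B uw min[of "insert w A"] by auto
  also have "\<dots> \<le> p - 1"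
    using degree_into_le_card[of A u w] uw fin A by (simp add: edge_commute)
  finally have w: "degree_into B w \<le> p - 1" .
  have one: "degree_into A x \<le> 1" if "x \<in> A" "x \<noteq> u" for x
    using degree_into_le_one_if_star[of A u x] that uw fin star by simp
  have one': "degree_into B y \<le> 1" if "y \<in> B" "y \<noteq> w" for y
    using degree_into_le_one_if_star[of B w y] that uw fin star by simp
  have bound: "degree_into A x + degree_into B y \<le> p + of_bool (x = u \<and> y = w)"
    if "x \<in> A" "y \<in> B" for x y
    using u w sum one[OF that(1)] one'[OF that(2)] by (cases "x = u"; cases "y = w") auto
  have "W \<le> (\<Sum>x\<in>A. \<Sum>y\<in>B. p * (1 - edge x y) + of_bool (x = u \<and> y = w))"
    unfolding W_def
  proof (intro sum_mono)
    fix x y assume "x \<in> A" "y \<in> B"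
    then show "(1 - edge x y) * (degree_into A x + degree_into B y)
        \<le> p * (1 - edge x y) + of_bool (x = u \<and> y = w)"
      using bound[of x y] by (cases "adj x y") (auto simp: edge_def)
  qed
  also have "\<dots> = p * miss + (\<Sum>x\<in>A. \<Sum>y\<in>B. of_bool (x = u) * of_bool (y = w))"
    by (simp add: miss_def sum.distrib sum_distrib_left of_bool_conj)
  also have "(\<Sum>x\<in>A. \<Sum>y\<in>B. of_bool (x = u) * of_bool (y = w)) = (1 :: int)"
    using fin uw by (simp flip: sum_distrib_left sum_distrib_right)
  finally show ?thesis using star u w sum by simp
qed

section \<open>A case of the Lovasz-Simonovits theorem\<close>

text \<open>
  For a minimum cut with parts of sizes \<open>p - s\<close> and \<open>p + 1 + s\<close>, twice the number of missing
  pairs is at most the number of uncut arcs minus \<open>2 * (q + s + s\<^sup>2)\<close>. In the bound of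
  \<open>ordered_triangles_ge_cut\<close> the uncut arcs enter with a factor of at least \<open>p - s\<close>, and the
  missing pairs cost \<open>2 * p\<close> each, so what remains is at least
  \<open>2 * p * (q + s + s\<^sup>2) - s * (2 * p + 2) = 2 * p * q + 2 * s * (p * s - 1)\<close>.
\<close>

theorem ordered_triangles_lower_bound:
  fixes p q :: nat
  assumes n: "card V = 2 * p + 1" and m: "arcs_within V \<ge> 2 * (int p ^ 2 + int p + int q)"
    and q: "2 * q \<le> p + 2"
  shows "ordered_triangles \<ge> 6 * int p * int q"
proof (rule ccontr)
  assume "\<not> ?thesis"
  then have few: "ordered_triangles < 6 * int p * int q" by simp
  obtain x where x: "uncut_arcs {y\<in>V. adj x y} < 4 * int q"
    using exists_neighbourhood_cut[OF _ m _ few] n by auto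
  have "0 \<le> ordered_triangles"
    unfolding ordered_triangles_def triangle_def by (intro sum_nonneg mult_nonneg_nonneg edge_bounds)
  with few have p: "0 < p" by (cases p) auto
  obtain A where A: "A \<subseteq> V" "card A \<le> p" and min: "\<And>S. S \<subseteq> V \<Longrightarrow> uncut_arcs A \<le> uncut_arcs S"
    using exists_minimum_cut[OF n] by metis
  define B where "B = V - A"
  define s where "s = int p - int (card A)"
  define W where "W = (\<Sum>u\<in>A. \<Sum>w\<in>B. (1 - edge u w) * (degree_into A u + degree_into B w))"
  define miss where "miss = (\<Sum>u\<in>A. \<Sum>w\<in>B. 1 - edge u w)"
  have fin: "finite A" "finite B" using A finite_V by (auto simp: B_def intro: finite_subset)
  have "card B = card V - card A" unfolding B_def using fin A by (intro card_Diff_subset)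
  then have cards: "int (card A) = int p - s" "int (card B) = int p + 1 + s" and s: "0 \<le> s"
    using n A by (auto simp: s_def)
  \<comment> \<open>Parity turns the strict bound into one that allows at most \<open>p + 1\<close> uncut edges.\<close>
  have "even (uncut_arcs A)"
    using arcs_within_even fin by (simp add: uncut_arcs_def B_def)
  moreover have "uncut_arcs A < 2 * int p + 4"
    using min[of "{y\<in>V. adj x y}"] x q by auto
  ultimately have small: "uncut_arcs A \<le> 2 * int p + 2" by presburger
  have "(\<Sum>u\<in>A. \<Sum>w\<in>B. edge u w) = int (card A) * int (card B) - miss"
    by (simp add: miss_def sum_subtractf)
  then have "uncut_arcs A = arcs_within V - 2 * ((int p - s) * (int p + 1 + s)) + 2 * miss"
    using arcs_within_V_split[OF A(1)] cards by (simp add: B_def)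
  then have "2 * miss \<le> uncut_arcs A - 2 * int q - 2 * s - 2 * s\<^sup>2"
    using m by (simp add: algebra_simps power2_eq_square)
  then have miss: "int p * (2 * miss) \<le> int p * (uncut_arcs A - 2 * int q - 2 * s - 2 * s\<^sup>2)"
    by (intro mult_left_mono) auto
  \<comment> \<open>An unbalanced cut only helps: \<open>s * (p * s - 1)\<close> is nonnegative for integers \<open>s \<ge> 0\<close> and \<open>p \<ge> 1\<close>.\<close>
  have "s * 1 \<le> s * (int p * s)"
  proof (cases "s = 0")
    case False
    then have "1 * 1 \<le> int p * s" using s p by (intro mult_mono) auto
    then show ?thesis using s by (intro mult_left_mono) auto
  qed simp
  moreover have "s * uncut_arcs A \<le> s * (2 * int p + 2)"
    using small s by (intro mult_left_mono)
  ultimately have balance: "2 * int p * int q \<le> (int p - s) * uncut_arcs A - 2 * (int p * miss)"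
    using miss by (simp add: algebra_simps power2_eq_square)
  \<comment> \<open>Arcs within the smaller part see \<open>p + 1 + s\<close> opposite vertices instead of \<open>p - s\<close>. One unit of this surplus pays for the exceptional missing pair.\<close>
  have "(int p - s) * uncut_arcs A + arcs_within A + 2 * s * arcs_within A - 2 * W
      = int (card B) * arcs_within A + int (card A) * arcs_within B - 2 * W"
    unfolding uncut_arcs_def B_def[symmetric] cards by (simp add: algebra_simps)
  moreover have "0 \<le> s * arcs_within A" using s arcs_within_nonneg by simp
  ultimately have "3 * ((int p - s) * uncut_arcs A + arcs_within A - 2 * W) \<le> ordered_triangles"
    using ordered_triangles_ge_cut[OF A(1) B_def] unfolding W_def by simp
  moreover have "2 * W \<le> 2 * (int p * miss) + arcs_within A"
    using missing_cross_weight[OF A(1) _ B_def min small] A(2) arcs_within_nonneg[of A]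
    unfolding W_def miss_def by auto
  ultimately show False using balance few by simp
qed

section \<open>The Ore-type degree condition\<close>

text \<open>
  Each vertex \<open>x\<close> occurs in as many nonadjacent pairs as it has non-neighbours, so the sum of
  the hypothesis over these pairs compares the sum of the excesses \<open>e x\<close> with the sum of their
  squares.
\<close>

lemma ore_arc_count:
  fixes p :: nat
  assumes n: "card V = 2 * p + 1" and p: "0 < p"
    and ore: "\<And>x y. x \<in> V \<Longrightarrow> y \<in> V \<Longrightarrow> x \<noteq> y \<Longrightarrow> \<not> adj x y
      \<Longrightarrow> degree_into V x + degree_into V y \<ge> 2 * int p + 2"
  shows "arcs_within V \<ge> (2 * int p + 1) * (int p + 1)"
proof -
  define e where "e x = degree_into V x - int p - 1" for x
  \<comment> \<open>the indicator of nonadjacent pairs of distinct vertices\<close>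
  define h where "h x y = 1 - edge x y - of_bool (x = y)" for x y
  have h: "(\<Sum>y\<in>V. h x y) = int p - 1 - e x" if "x \<in> V" for x
    using that n finite_V by (simp add: h_def sum_subtractf e_def degree_into_def)
  have hsym: "h x y = h y x" for x y by (auto simp: h_def edge_commute)
  have "0 \<le> (\<Sum>x\<in>V. \<Sum>y\<in>V. h x y * (e x + e y))"
  proof (intro sum_nonneg)
    fix x y assume "x \<in> V" "y \<in> V"
    then show "0 \<le> h x y * (e x + e y)"
      using ore[of x y] by (cases "x = y"; cases "adj x y") (auto simp: h_def e_def edge_def adj_irrefl)
  qed
  also have "\<dots> = (\<Sum>x\<in>V. \<Sum>y\<in>V. h x y * e x) + (\<Sum>x\<in>V. \<Sum>y\<in>V. h x y * e y)"
    by (simp add: distrib_left sum.distrib)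
  also have "(\<Sum>x\<in>V. \<Sum>y\<in>V. h x y * e y) = (\<Sum>x\<in>V. \<Sum>y\<in>V. h x y * e x)"
    by (subst sum.swap) (simp add: hsym)
  also have "(\<Sum>x\<in>V. \<Sum>y\<in>V. h x y * e x) = (\<Sum>x\<in>V. (int p - 1 - e x) * e x)"
    by (simp add: h flip: sum_distrib_right)
  also have "\<dots> = (int p - 1) * (\<Sum>x\<in>V. e x) - (\<Sum>x\<in>V. (e x)\<^sup>2)"
    by (simp add: left_diff_distrib sum_subtractf sum_distrib_left power2_eq_square)
  finally have sq: "(\<Sum>x\<in>V. (e x)\<^sup>2) \<le> (int p - 1) * (\<Sum>x\<in>V. e x)"
    by (simp add: mult.commute)
  have "0 \<le> (\<Sum>x\<in>V. e x)"
  \<comment> \<open>For three vertices the factor \<open>p - 1\<close> vanishes, but then the squares vanish too.\<close>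
  proof (cases "p = 1")
    case True
    with sq have "(\<Sum>x\<in>V. (e x)\<^sup>2) = 0" by (simp add: sum_nonneg antisym)
    then have "\<forall>x\<in>V. e x = 0" using finite_V by (simp add: sum_nonneg_eq_0_iff)
    then show ?thesis by simp
  next
    case False
    have "0 \<le> (int p - 1) * (\<Sum>x\<in>V. e x)"
      using sq by (meson order_trans sum_nonneg zero_le_power2)
    then show ?thesis using False p by (simp add: zero_le_mult_iff)
  qed
  then show ?thesis
    by (simp add: e_def sum_subtractf arcs_within_def n algebra_simps)
qed

text \<open>
  The degree sum is at least \<open>(2 * p + 1) * (p + 1)\<close>. If \<open>p\<close> is even, this number is odd, and
  only the parity of the degree sum provides the last half edge needed for \<open>2 * q = p + 2\<close>.
\<close>

lemma ore_ordered_triangles: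
  fixes p q :: nat
  assumes n: "card V = 2 * p + 1" and p: "0 < p"
    and ore: "\<And>x y. x \<in> V \<Longrightarrow> y \<in> V \<Longrightarrow> x \<noteq> y \<Longrightarrow> \<not> adj x y
      \<Longrightarrow> degree_into V x + degree_into V y \<ge> 2 * int p + 2"
    and q: "2 * q \<le> p + 2"
  shows "ordered_triangles \<ge> 6 * int p * int q"
proof (rule ordered_triangles_lower_bound[OF n])
  have "arcs_within V \<ge> 2 * (int p ^ 2 + int p) + int p + 1"
    using ore_arc_count[OF n p ore] by (simp add: algebra_simps power2_eq_square)
  moreover obtain r where r: "arcs_within V = 2 * r"
    using arcs_within_even[OF finite_V] by (elim evenE)
  moreover have "2 * int q \<le> int p + 2" using q by simp
  ultimately have "int p ^ 2 + int p + int q \<le> r" by auto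
  then show "arcs_within V \<ge> 2 * (int p ^ 2 + int p + int q)"
    by (simp add: r)
  show "2 * q \<le> p + 2" by (rule q)
qed

section \<open>From ordered triangles to subgraphs\<close>

definition triangle_sets :: "'a set set" where
  "triangle_sets = {T. T \<subseteq> V \<and> card T = 3 \<and> (\<forall>x\<in>T. \<forall>y\<in>T. x \<noteq> y \<longrightarrow> adj x y)}"

lemma ordered_triangles_le: "ordered_triangles \<le> 6 * int (card triangle_sets)"
proof -
  define P where "P = {(x, y, z). x \<in> V \<and> y \<in> V \<and> z \<in> V \<and> adj x y \<and> adj y z \<and> adj x z}"
  define orders where "orders T = {(x, y, z). x \<in> T \<and> y \<in> T \<and> z \<in> T \<and> x \<noteq> y \<and> y \<noteq> z \<and> x \<noteq> z}" for T :: "'a set"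
  have fin: "finite triangle_sets"
    by (rule finite_subset[of _ "Pow V"]) (auto simp: triangle_sets_def finite_V)
  have orders: "finite (orders T) \<and> card (orders T) \<le> 6" if T: "T \<in> triangle_sets" for T
  proof -
    have "card T = 3" using T by (simp add: triangle_sets_def)
    then obtain a b c where abc: "T = {a, b, c}" unfolding card_3_iff by blast
    let ?L = "[(a,b,c), (a,c,b), (b,a,c), (b,c,a), (c,a,b), (c,b,a)]"
    have sub: "orders T \<subseteq> set ?L" by (auto simp: orders_def abc)
    have "card (orders T) \<le> length ?L"
      using card_mono[OF _ sub] card_length[of ?L] by simp
    then show ?thesis using finite_subset[OF sub] by simp
  qed
  have "ordered_triangles = (\<Sum>(x, y, z)\<in>V \<times> V \<times> V. of_bool ((x, y, z) \<in> P))"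
    by (simp add: ordered_triangles_def sum.cartesian_product P_def triangle_def edge_def of_bool_conj
        cong: sum.cong) (auto intro!: sum.cong)
  also have "\<dots> = int (card P)"
  proof -
    have "P \<subseteq> V \<times> V \<times> V" by (auto simp: P_def)
    then show ?thesis using finite_V by (simp add: case_prod_unfold Int_absorb1)
  qed
  also have "\<dots> \<le> int (card (\<Union>T\<in>triangle_sets. orders T))"
  proof -
    have "P \<subseteq> (\<Union>T\<in>triangle_sets. orders T)"
    proof
      fix t assume "t \<in> P"
      then obtain x y z where t: "t = (x, y, z)" "x \<in> V" "y \<in> V" "z \<in> V" "adj x y" "adj y z" "adj x z"
        by (auto simp: P_def)
      then have ne: "x \<noteq> y" "y \<noteq> z" "x \<noteq> z" using adj_irrefl by auto
      then have "{x, y, z} \<in> triangle_sets"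
        using t adj_sym by (auto simp: triangle_sets_def)
      moreover have "t \<in> orders {x, y, z}"
        using t ne by (simp add: orders_def)
      ultimately show "t \<in> (\<Union>T\<in>triangle_sets. orders T)"
        by blast
    qed
    then show ?thesis using fin orders by (simp add: card_mono)
  qed
  also have "\<dots> \<le> int (\<Sum>T\<in>triangle_sets. card (orders T))"
    by (intro of_nat_mono card_UN_le fin)
  also have "\<dots> \<le> int (\<Sum>T\<in>triangle_sets. 6)"
    using orders by (intro of_nat_mono sum_mono) auto
  also have "\<dots> = 6 * int (card triangle_sets)" by simp
  finally show ?thesis .
qed

end

lemma ore_triangles:
  fixes G :: "('a, 'b) pre_digraph" and p q :: nat
  assumes G: "graph G" and n: "card (verts G) = 2 * p + 1" and p: "0 < p"
    and ore: "\<And>x y. x \<in> verts G \<Longrightarrow> y \<in> verts G \<Longrightarrow> x \<noteq> y \<Longrightarrow> \<not> x \<rightarrow>\<^bsub>G\<^esub> y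
           \<Longrightarrow> out_degree G x + out_degree G y \<ge> 2 * p + 2"
    and q: "2 * q \<le> p + 2"
  shows "card (triangles G) \<ge> p * q"
proof -
  interpret graph G by fact
  interpret S: simple_graph_on "verts G" "\<lambda>x y. x \<rightarrow>\<^bsub>G\<^esub> y"
    by unfold_locales (auto intro: graph_symmetric dest: adj_not_same)
  have deg: "S.degree_into (verts G) x = int (out_degree G x)" for x
  proof -
    have "verts G \<inter> {y. x \<rightarrow>\<^bsub>G\<^esub> y} = {y. x \<rightarrow>\<^bsub>G\<^esub> y}" by auto
    then show ?thesis
      by (simp add: S.degree_into_def S.edge_def out_degree_eq_card_neighbours[OF G])
  qed
  have "6 * int p * int q \<le> S.ordered_triangles"
  proof (rule S.ore_ordered_triangles[OF n p _ q])
    fix x y assume "x \<in> verts G" "y \<in> verts G" "x \<noteq> y" "\<not> x \<rightarrow>\<^bsub>G\<^esub> y"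
    then show "2 * int p + 2 \<le> S.degree_into (verts G) x + S.degree_into (verts G) y"
      using ore[of x y] by (simp add: deg)
  qed
  also have "\<dots> \<le> 6 * int (card S.triangle_sets)" by (rule S.ordered_triangles_le)
  also have "card S.triangle_sets = card (triangles G)"
    using bij_betw_same_card[OF bij_betw_verts_triangles[OF G]] by (simp add: S.triangle_sets_def)
  finally have "int (p * q) \<le> int (card (triangles G))" by simp
  then show ?thesis by (simp only: of_nat_le_iff)
qed

theorem theorem9:
  fixes G :: "('a, 'b) pre_digraph" and n :: nat
  assumes "graph G"
    and "card (verts G) = n"
    and "\<And>x y. x \<in> verts G \<Longrightarrow> y \<in> verts G \<Longrightarrow> x \<noteq> y \<Longrightarrow> \<not> x \<rightarrow>\<^bsub>G\<^esub> y
           \<Longrightarrow> out_degree G x + out_degree G y \<ge> n + 1"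
  shows "(\<forall>k::nat. k > 0 \<and> n = 4 * k - 1 \<longrightarrow>
            card (triangles G) \<ge> k * (2 * k - 1) \<and>
            real (k * (2 * k - 1)) = ((real n)\<^sup>2 - 1) / 8) \<and>
         (\<forall>k::nat. k > 0 \<and> n = 4 * k + 1 \<longrightarrow>
            card (triangles G) \<ge> 2 * k * (k + 1) \<and>
            real (2 * k * (k + 1)) = ((real n)\<^sup>2 + 2 * real n - 3) / 8)"
proof (intro conjI allI impI; elim conjE)
  fix k :: nat assume k: "k > 0" "n = 4 * k - 1"
  have "n = 2 * (2 * k - 1) + 1" using k by auto
  then show "card (triangles G) \<ge> k * (2 * k - 1)"
    using ore_triangles[OF assms(1), of "2 * k - 1" k] assms(2,3) k by (simp add: mult.commute)
  show "real (k * (2 * k - 1)) = ((real n)\<^sup>2 - 1) / 8"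
    using k by (simp add: of_nat_diff power2_eq_square field_simps)
next
  fix k :: nat assume k: "k > 0" "n = 4 * k + 1"
  then show "card (triangles G) \<ge> 2 * k * (k + 1)"
    using ore_triangles[OF assms(1), of "2 * k" "k + 1"] assms(2,3) by simp
  show "real (2 * k * (k + 1)) = ((real n)\<^sup>2 + 2 * real n - 3) / 8"
    using k by (simp add: power2_eq_square field_simps)
qed

end
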